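(* Let $F:\mathbb{R}^n\rightrightarrows\mathbb{R}^n$ be a set-valued mapping with graph locally closed around $(\bar x,0)\in\mathrm{gph}\,F$. Assume that $F$ is SCD semismooth$^*$ at $(\bar x,0)$ and that there are $\eta,\kappa>0$ such that for every $x\notin F^{-1}(0)$ sufficiently close to $\bar x$ we have $\mathcal{G}^{\eta,\kappa}_{F,\bar x}(x)\neq\emptyset$. Then there exists some $\delta>0$ such that for every starting point $x^{(0)}\in\mathcal{B}_\delta(\bar x)$ the SCD semismooth$^*$ Newton-type method (described in the context) either stops after finitely many iterations at a solution of $0\in F(x)$ or produces a sequence $x^{(k)}$ which converges superlinearly to $\bar x$, provided we choose in every iteration $(\hat x^{(k)},\hat y^{(k)},L^{(k)})\in\mathcal{G}^{\eta,\kappa}_{F,\bar x}(x^{(k)})$.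
   Context: Norms are Euclidean (operator norm for matrices); $\mathcal{B}_\delta(z)$ is the closed ball. $\mathrm{gph}\,F=\{(x,y)\mid y\in F(x)\}$. For a set $A$ and $\bar z\in A$, the tangent cone $T_A(\bar z)$ is the set of all $w$ for which there are $t_k\downarrow0$, $w_k\to w$ with $\bar z+t_kw_k\in A$ for all $k$. $\mathcal{Z}_n$ is the set of $n$-dimensional linear subspaces of $\mathbb{R}^{2n}=\mathbb{R}^n\times\mathbb{R}^n$ with metric $d_{\mathcal{Z}}(L_1,L_2)=\|P_1-P_2\|$, $P_i$ the orthogonal projection onto $L_i$. $L^*:=\{(-v^*,u^* )\mid(u^*,v^* )\in L^\perp\}$. For $n\times n$ matrices $B,A$, $\mathrm{rge}(B,A):=\{(Bp,Ap)\mid p\in\mathbb{R}^n\}$. $\mathcal{Z}_n^{\rm reg}$ is the set of all $L\in\mathcal{Z}_n$ such that $(y^*,0)\in L\Rightarrow y^*=0$; for $L\in\mathcal{Z}_n^{\rm reg}$, $C_L$ is the unique $n\times n$ matrix with $L=\mathrm{rge}(C_L,I)$. $\mathcal{O}_F$ is the set of $(x,y)\in\mathrm{gph}\,F$ with $T_{\mathrm{gph}\,F}(x,y)\in\mathcal{Z}_n$. For $(x,y)\in\mathrm{gph}\,F$, $\mathcal{S}^*F(x,y)$ is the set of all $L\in\mathcal{Z}_n$ for which there is a sequence $(x_k,y_k)\to(x,y)$ in $\mathcal{O}_F$ with $d_{\mathcal{Z}}(L,T_{\mathrm{gph}\,F}(x_k,y_k)^* )\to0$; $\bigcup\mathcal{S}^*F(x,y)$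 is the union of these subspaces. $F$ has the SCD property around $(x,y)$ if $\mathcal{S}^*F(x',y')\neq\emptyset$ for all $(x',y')\in\mathrm{gph}\,F$ in some neighborhood of $(x,y)$. $F$ is SCD semismooth$^*$ at $(\bar x,\bar y)\in\mathrm{gph}\,F$ if $F$ has the SCD property around $(\bar x,\bar y)$ and for every $\epsilon>0$ there is $\delta>0$ such that $|\langle x^*,x-\bar x\rangle-\langle y^*,y-\bar y\rangle|\le\epsilon\|(x,y)-(\bar x,\bar y)\|\,\|(x^*,y^* )\|$ for all $(x,y)\in\mathrm{gph}\,F\cap\mathcal{B}_\delta(\bar x,\bar y)$ and all $(y^*,x^* )\in\bigcup\mathcal{S}^*F(x,y)$. For $\eta,\kappa>0$ and $x\in\mathbb{R}^n$, $$\mathcal{G}^{\eta,\kappa}_{F,\bar x}(x):=\{(\hat x,\hat y,L)\mid(\hat x,\hat y)\in\mathrm{gph}\,F,\ \|(\hat x,\hat y)-(\bar x,0)\|\le\eta\|x-\bar x\|,\ L\in\mathcal{S}^*F(\hat x,\hat y)\cap\mathcal{Z}_n^{\rm reg},\ \|C_L\|\le\kappa\}.$$ SCD semismooth$^*$ Newton-type method for $0\in F(x)$. 1. Choose $x^{(0)}$, set $k:=0$. 2. If $0\in F(x^{(k)})$, stop. 3. Approximation step: compute $(\hat x^{(k)},\hat y^{(k)})\in\mathrm{gph}\,F$ with $\|(\hat x^{(k)},\hat y^{(k)})-(\bar x,0)\|\le\eta\|x^{(k)}-\bar x\|$ and $\mathcal{S}^*F(\hat x^{(k)},\hat y^{(k)})\cap\mathcal{Z}_n^{\rm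 reg}\neq\emptyset$. 4. Newton step: select $n\times n$ matrices $A^{(k)},B^{(k)}$ with $L^{(k)}:=\mathrm{rge}({B^{(k)}}^T,{A^{(k)}}^T)\in\mathcal{S}^*F(\hat x^{(k)},\hat y^{(k)})\cap\mathcal{Z}_n^{\rm reg}$, let $\Delta x^{(k)}$ solve $A^{(k)}\Delta x=-B^{(k)}\hat y^{(k)}$ (equivalently $\Delta x^{(k)}=-C_{L^{(k)}}^T\hat y^{(k)}$), and set $x^{(k+1)}=\hat x^{(k)}+\Delta x^{(k)}$. 5. Set $k:=k+1$ and go to 2. Superlinear convergence means $x^{(k)}\to\bar x$ and $\|x^{(k+1)}-\bar x\|=o(\|x^{(k)}-\bar x\|)$. *)

theory Defs
  imports
    "HOL-Analysis.Analysis"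
    "HOL-Library.Extended_Nat"
    "HOL-Library.Landau_Symbols"
begin

definition gph :: "('a \<Rightarrow> 'b set) \<Rightarrow> ('a \<times> 'b) set" where
  "gph F = {(x, y). y \<in> F x}"

definition locally_closed_around :: "'a::metric_space set \<Rightarrow> 'a \<Rightarrow> bool" where
  "locally_closed_around A z \<longleftrightarrow> (\<exists>r>0. closed (A \<inter> cball z r))"

text \<open>As usual in variational analysis, \<open>t\<^sub>k \<down> 0\<close> is read as \<open>t\<^sub>k > 0\<close> and \<open>t\<^sub>k \<rightarrow> 0\<close>;
  requiring monotonicity as well would give the same cone, by passing to subsequences.\<close>

definition tangent_cone :: "'a::real_normed_vector set \<Rightarrow> 'a \<Rightarrow> 'a set" where
  "tangent_cone A z = {w. \<exists>t v. (\<forall>k. 0 < t k) \<and> t \<longlonglongrightarrow> 0 \<and> v \<longlonglongrightarrow> w \<and>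
     (\<forall>k::nat. z + t k *\<^sub>R v k \<in> A)}"

definition orth_proj :: "'a::euclidean_space set \<Rightarrow> 'a \<Rightarrow> 'a" where
  "orth_proj L z = (THE p. p \<in> L \<and> z - p \<in> orthogonal_comp L)"

definition Zn :: "((real^'n) \<times> (real^'n)) set set" where
  "Zn = {L. subspace L \<and> dim L = CARD('n)}"

definition dZ :: "((real^'n) \<times> (real^'n)) set \<Rightarrow> ((real^'n) \<times> (real^'n)) set \<Rightarrow> real" where
  "dZ L1 L2 = onorm (\<lambda>z. orth_proj L1 z - orth_proj L2 z)"

definition adj :: "((real^'n) \<times> (real^'n)) set \<Rightarrow> ((real^'n) \<times> (real^'n)) set" where
  "adj L = {(- v, u) |u v. (u, v) \<in> orthogonal_comp L}"

definition rge :: "real^'n^'n \<Rightarrow> real^'n^'n \<Rightarrow> ((real^'n) \<times> (real^'n)) set" where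
  "rge B A = {(B *v p, A *v p) |p. True}"

definition Zn_reg :: "((real^'n) \<times> (real^'n)) set set" where
  "Zn_reg = {L \<in> Zn. \<forall>y. (y, 0) \<in> L \<longrightarrow> y = 0}"

text \<open>Only meaningful for \<open>L \<in> Zn_reg\<close>, where the matrix exists and is unique.\<close>

definition C_mat :: "((real^'n) \<times> (real^'n)) set \<Rightarrow> real^'n^'n" where
  "C_mat L = (THE C. L = rge C (mat 1))"

definition O_set :: "(real^'n \<Rightarrow> (real^'n) set) \<Rightarrow> ((real^'n) \<times> (real^'n)) set" where
  "O_set F = {z \<in> gph F. tangent_cone (gph F) z \<in> Zn}"

definition adj_SC_deriv ::
    "(real^'n \<Rightarrow> (real^'n) set) \<Rightarrow> (real^'n) \<times> (real^'n) \<Rightarrow> ((real^'n) \<times> (real^'n)) set set" where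
  "adj_SC_deriv F z = {L \<in> Zn. \<exists>s. (\<forall>k. s k \<in> O_set F) \<and> s \<longlonglongrightarrow> z \<and>
     (\<lambda>k. dZ L (adj (tangent_cone (gph F) (s k)))) \<longlonglongrightarrow> 0}"

definition SCD_around :: "(real^'n \<Rightarrow> (real^'n) set) \<Rightarrow> (real^'n) \<times> (real^'n) \<Rightarrow> bool" where
  "SCD_around F z \<longleftrightarrow> (\<forall>\<^sub>F z' in nhds z. z' \<in> gph F \<longrightarrow> adj_SC_deriv F z' \<noteq> {})"

text \<open>Elements of the subspaces in \<open>adj_SC_deriv F (x, y)\<close> are ordered as \<open>(y\<^sup>*, x\<^sup>*)\<close>,
  written \<open>(ys, xs)\<close> below.\<close>

definition SCD_semismooth_star ::
    "(real^'n \<Rightarrow> (real^'n) set) \<Rightarrow> (real^'n) \<times> (real^'n) \<Rightarrow> bool" where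
  "SCD_semismooth_star F zbar \<longleftrightarrow> zbar \<in> gph F \<and> SCD_around F zbar \<and>
     (\<forall>\<epsilon>>0. \<exists>\<delta>>0. \<forall>(x, y) \<in> gph F \<inter> cball zbar \<delta>. \<forall>(ys, xs) \<in> \<Union> (adj_SC_deriv F (x, y)).
        \<bar>xs \<bullet> (x - fst zbar) - ys \<bullet> (y - snd zbar)\<bar> \<le> \<epsilon> * norm ((x, y) - zbar) * norm (xs, ys))"

definition G_set ::
    "(real^'n \<Rightarrow> (real^'n) set) \<Rightarrow> real^'n \<Rightarrow> real \<Rightarrow> real \<Rightarrow> real^'n \<Rightarrow>
     ((real^'n) \<times> (real^'n) \<times> ((real^'n) \<times> (real^'n)) set) set" where
  "G_set F xbar \<eta> \<kappa> x = {(xh, yh, L).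
     (xh, yh) \<in> gph F \<and> norm ((xh, yh) - (xbar, 0)) \<le> \<eta> * norm (x - xbar) \<and>
     L \<in> adj_SC_deriv F (xh, yh) \<inter> Zn_reg \<and> onorm ((*v) (C_mat L)) \<le> \<kappa>}"

definition approximation_step ::
    "(real^'n \<Rightarrow> (real^'n) set) \<Rightarrow> real^'n \<Rightarrow> real \<Rightarrow> real^'n \<Rightarrow> real^'n \<Rightarrow> real^'n \<Rightarrow> bool" where
  "approximation_step F xbar \<eta> x xh yh \<longleftrightarrow>
     (xh, yh) \<in> gph F \<and> norm ((xh, yh) - (xbar, 0)) \<le> \<eta> * norm (x - xbar) \<and>
     adj_SC_deriv F (xh, yh) \<inter> Zn_reg \<noteq> {}"

definition newton_step ::
    "(real^'n \<Rightarrow> (real^'n) set) \<Rightarrow> real^'n \<Rightarrow> real^'n \<Rightarrow> real^'n^'n \<Rightarrow> real^'n^'n \<Rightarrow> real^'n \<Rightarrow> bool" where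
  "newton_step F xh yh A B x' \<longleftrightarrow>
     rge (transpose B) (transpose A) \<in> adj_SC_deriv F (xh, yh) \<inter> Zn_reg \<and>
     (\<exists>dx. A *v dx = - (B *v yh) \<and> x' = xh + dx)"

text \<open>The first \<open>N\<close> iterations of the method (all of them if \<open>N = \<infinity>\<close>); in particular none of the
  iterates \<open>x k\<close> with \<open>k < N\<close> triggers the stopping test. Values of the sequences beyond \<open>N\<close>
  are irrelevant.\<close>

definition newton_run ::
    "(real^'n \<Rightarrow> (real^'n) set) \<Rightarrow> real^'n \<Rightarrow> real \<Rightarrow> enat \<Rightarrow> (nat \<Rightarrow> real^'n) \<Rightarrow>
     (nat \<Rightarrow> real^'n) \<Rightarrow> (nat \<Rightarrow> real^'n) \<Rightarrow> (nat \<Rightarrow> real^'n^'n) \<Rightarrow> (nat \<Rightarrow> real^'n^'n) \<Rightarrow> bool" where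
  "newton_run F xbar \<eta> N x xh yh A B \<longleftrightarrow> (\<forall>k. enat k < N \<longrightarrow>
     0 \<notin> F (x k) \<and>
     approximation_step F xbar \<eta> (x k) (xh k) (yh k) \<and>
     newton_step F (xh k) (yh k) (A k) (B k) (x (Suc k)))"

definition choices_in_G ::
    "(real^'n \<Rightarrow> (real^'n) set) \<Rightarrow> real^'n \<Rightarrow> real \<Rightarrow> real \<Rightarrow> enat \<Rightarrow> (nat \<Rightarrow> real^'n) \<Rightarrow>
     (nat \<Rightarrow> real^'n) \<Rightarrow> (nat \<Rightarrow> real^'n) \<Rightarrow> (nat \<Rightarrow> real^'n^'n) \<Rightarrow> (nat \<Rightarrow> real^'n^'n) \<Rightarrow> bool" where
  "choices_in_G F xbar \<eta> \<kappa> N x xh yh A B \<longleftrightarrow> (\<forall>k. enat k < N \<longrightarrow>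
     (xh k, yh k, rge (transpose (B k)) (transpose (A k))) \<in> G_set F xbar \<eta> \<kappa> (x k))"

text \<open>The iteration at \<open>x\<close> cannot break down: a choice in \<open>G_set\<close> exists, and whichever one is
  made, matrices representing the chosen subspace exist and, for all of them, the linear system of
  the Newton step is solvable.\<close>

definition can_iterate ::
    "(real^'n \<Rightarrow> (real^'n) set) \<Rightarrow> real^'n \<Rightarrow> real \<Rightarrow> real \<Rightarrow> real^'n \<Rightarrow> bool" where
  "can_iterate F xbar \<eta> \<kappa> x \<longleftrightarrow> G_set F xbar \<eta> \<kappa> x \<noteq> {} \<and>
     (\<forall>(xh, yh, L) \<in> G_set F xbar \<eta> \<kappa> x.
        (\<exists>A B. L = rge (transpose B) (transpose A)) \<and>
        (\<forall>A B. L = rge (transpose B) (transpose A) \<longrightarrow> (\<exists>dx. A *v dx = - (B *v yh))))"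

text \<open>A run of length \<open>N\<close> is complete if it is infinite or has ended, either by the stopping test
  or by a possible breakdown of the next iteration.\<close>

definition complete_run ::
    "(real^'n \<Rightarrow> (real^'n) set) \<Rightarrow> real^'n \<Rightarrow> real \<Rightarrow> real \<Rightarrow> enat \<Rightarrow> (nat \<Rightarrow> real^'n) \<Rightarrow> bool" where
  "complete_run F xbar \<eta> \<kappa> N x \<longleftrightarrow>
     (\<forall>m. N = enat m \<longrightarrow> 0 \<in> F (x m) \<or> \<not> can_iterate F xbar \<eta> \<kappa> (x m))"

definition superlinear_conv :: "(nat \<Rightarrow> 'a::real_normed_vector) \<Rightarrow> 'a \<Rightarrow> bool" where
  "superlinear_conv x xbar \<longleftrightarrow> x \<longlonglongrightarrow> xbar \<and>
     (\<lambda>k. norm (x (Suc k) - xbar)) \<in> o(\<lambda>k. norm (x k - xbar))"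

end

theory Submission
  imports Defs
begin

text \<open>For a subspace \<open>L = rge C I\<close> with \<open>\<parallel>C\<parallel> \<le> \<kappa>\<close>, the new error \<open>u = x' - xbar\<close> yields the element
  \<open>(C u, u)\<close> of \<open>L\<close>, and the Newton equation gives
  \<open>\<parallel>u\<parallel>\<^sup>2 = \<langle>u, xh - xbar\<rangle> - \<langle>C u, yh\<rangle>\<close>. This is exactly the quantity controlled by SCD
  semismoothness, so \<open>\<parallel>u\<parallel> \<le> \<epsilon> \<eta> (1 + \<kappa>) \<parallel>x - xbar\<parallel>\<close> for \<open>x\<close> near \<open>xbar\<close>. With \<open>\<epsilon>\<close> small
  the error is at least halved in each iteration, so the iterates remain where \<open>G_set\<close> is nonempty,
  and letting \<open>\<epsilon>\<close> tend to zero gives the superlinear rate.\<close>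

text \<open>Regularity says that \<open>snd\<close> has trivial kernel on \<open>L\<close>. As
  \<open>L\<close> has dimension n, \<open>snd\<close> maps it bijectively onto the whole space, and
  \<open>C\<close> is the matrix of \<open>fst\<close> composed with the inverse
  \<open>g\<close>.\<close>

lemma Zn_reg_rge_ex:
  fixes L :: "((real^'n) \<times> (real^'n)) set"
  assumes "L \<in> Zn_reg"
  shows "\<exists>C. L = rge C (mat 1)"
proof -
  have sub: "subspace L" and dim: "dim L = CARD('n)"
    and reg: "\<And>y. (y, 0) \<in> L \<Longrightarrow> y = 0"
    using assms by (auto simp: Zn_reg_def Zn_def)
  have lin: "linear (snd :: (real^'n) \<times> (real^'n) \<Rightarrow> real^'n)"
    by (simp add: linear_snd)
  have inj: "inj_on snd L"
  proof (rule inj_onI)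
    fix a b assume ab: "a \<in> L" "b \<in> L" "snd a = snd b"
    then have "(fst (a - b), 0) \<in> L"
      using subspace_diff[OF sub, of a b] by (metis diff_self prod.collapse snd_diff)
    then show "a = b"
      using reg[of "fst (a - b)"] ab(3) by (simp add: prod_eq_iff)
  qed
  obtain g where g: "g ` UNIV \<subseteq> L" "linear g" and gL: "\<And>z. z \<in> L \<Longrightarrow> g (snd z) = z"
    using linear_exists_left_inverse_on[OF lin sub inj] by blast
  have "dim (snd ` L) = CARD('n)"
    using dim_image_eq[OF lin, of L] inj sub dim by (simp add: span_eq_iff[THEN iffD2])
  then have surj: "snd ` L = UNIV"
    using subspace_dim_equal[of "snd ` L" UNIV] linear_subspace_image[OF lin sub]
    by (simp add: dim_UNIV)
  have snd_g: "snd (g u) = u" for u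
    using surj gL by (metis UNIV_I imageE)
  have "linear (fst \<circ> g)"
    using g(2) linear_compose linear_fst by blast
  then have C: "matrix (fst \<circ> g) *v u = fst (g u)" for u
    by (simp add: matrix_works)
  have "L = rge (matrix (fst \<circ> g)) (mat 1)"
    unfolding rge_def C
  proof (intro equalityI subsetI)
    fix z assume "z \<in> L"
    then show "z \<in> {(fst (g p), mat 1 *v p) |p. True}"
      by (auto simp: gL intro!: exI[of _ "snd z"])
  next
    fix z assume "z \<in> {(fst (g p), mat 1 *v p) |p. True}"
    then obtain p where "z = g p"
      by (auto simp: prod_eq_iff snd_g)
    then show "z \<in> L" using g(1) by blast
  qed
  then show ?thesis by blast
qed

lemma rge_mat_1_inj: "rge C (mat 1) = rge D (mat 1) \<Longrightarrow> C = D"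
  unfolding rge_def matrix_eq by (auto simp: set_eq_iff)

lemma rge_C_mat:
  assumes "L \<in> Zn_reg"
  shows "L = rge (C_mat L) (mat 1)"
proof -
  have "\<exists>!C. L = rge C (mat 1)"
    using Zn_reg_rge_ex[OF assms] rge_mat_1_inj by metis
  then show ?thesis
    unfolding C_mat_def by (rule theI')
qed

text \<open>The point of \<open>L\<close> with second component \<open>u\<close> has some parameter
  \<open>p\<close> in the representation by \<open>B\<close> and \<open>A\<close>. This yields both
  surjectivity of \<open>A\<close> and access to \<open>C_mat\<close> without inverting
  anything.\<close>

lemma rge_solve:
  assumes "rge B A \<in> Zn_reg"
  obtains p where "u = A *v p" "C_mat (rge B A) *v u = B *v p"
proof -
  have "(C_mat (rge B A) *v u, mat 1 *v u) \<in> rge (C_mat (rge B A)) (mat 1)"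
    unfolding rge_def by blast
  then have "(C_mat (rge B A) *v u, u) \<in> rge B A"
    using rge_C_mat[OF assms] by simp
  then obtain p where "(C_mat (rge B A) *v u, u) = (B *v p, A *v p)"
    unfolding rge_def by blast
  then show thesis using that[of p] by blast
qed

text \<open>Regularity makes \<open>transpose A\<close> surjective. A square matrix with a right
  inverse is invertible, so \<open>A\<close> is invertible as well.\<close>

lemma rge_transpose_solvable:
  fixes A B :: "real^'n^'n"
  assumes "rge (transpose B) (transpose A) \<in> Zn_reg"
  shows "\<exists>dx. A *v dx = b"
proof -
  have "surj ((*v) (transpose A))"
    using rge_solve[OF assms] by (metis surj_def)
  then obtain D where "transpose A ** D = mat 1"
    using matrix_right_invertible_surjective by blast
  then have "transpose D ** A = mat 1"
    by (metis matrix_transpose_mul transpose_mat transpose_transpose)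
  then have "A ** transpose D = mat 1"
    using matrix_left_right_inverse by blast
  then have "A *v (transpose D *v b) = b"
    by (simp add: matrix_vector_mul_assoc del: transpose_matrix_vector)
  then show ?thesis by blast
qed

text \<open>Every subspace offered by \<open>G_set\<close> is regular, so the linear algebra never
  fails: the only possible breakdown is an empty \<open>G_set\<close>.\<close>

lemma can_iterate_iff:
  "can_iterate F xbar \<eta> \<kappa> x \<longleftrightarrow> G_set F xbar \<eta> \<kappa> x \<noteq> {}"
proof -
  have "\<exists>A B. L = rge (transpose B) (transpose A)" if "L \<in> Zn_reg" for L :: "((real^'n) \<times> (real^'n)) set"
    using Zn_reg_rge_ex[OF that] by (metis transpose_transpose)
  then show ?thesis
    unfolding can_iterate_def by (auto simp: G_set_def intro: rge_transpose_solvable)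
qed

text \<open>The radius depends on \<open>c\<close> but not on the choices made in the step. The
  factor 1/2 will give convergence, and arbitrary \<open>c\<close> the superlinear rate.\<close>

lemma newton_step_contraction:
  fixes F :: "real^'n \<Rightarrow> (real^'n) set"
  assumes ss: "SCD_semismooth_star F (xbar, 0)" and "\<eta> > 0" "\<kappa> > 0" "c > 0"
  shows "\<exists>\<delta>>0. \<forall>x xh yh A B x'. norm (x - xbar) \<le> \<delta> \<longrightarrow> newton_step F xh yh A B x' \<longrightarrow>
    (xh, yh, rge (transpose B) (transpose A)) \<in> G_set F xbar \<eta> \<kappa> x \<longrightarrow>
    norm (x' - xbar) \<le> c * norm (x - xbar)"
proof -
  \<comment> \<open>Two factors have to be absorbed: \<eta> from the approximation step and 1 +
    \<kappa> from bounding \<open>norm (u, v)\<close> by \<open>norm u\<close>.\<close>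
  define \<epsilon> where "\<epsilon> = c / (\<eta> * (1 + \<kappa>))"
  have "\<epsilon> > 0" using assms by (simp add: \<epsilon>_def)
  then obtain \<delta> where "\<delta> > 0" and
    ball: "\<forall>(x, y) \<in> gph F \<inter> cball (xbar, 0) \<delta>. \<forall>(ys, xs) \<in> \<Union> (adj_SC_deriv F (x, y)).
      \<bar>xs \<bullet> (x - xbar) - ys \<bullet> (y - 0)\<bar> \<le> \<epsilon> * norm ((x, y) - (xbar, 0)) * norm (xs, ys)"
    using ss[unfolded SCD_semismooth_star_def fst_conv snd_conv, THEN conjunct2, THEN conjunct2,
        THEN spec, THEN mp, of \<epsilon>] by blast
  have \<delta>: "\<bar>xs \<bullet> (x - xbar) - ys \<bullet> y\<bar> \<le> \<epsilon> * norm ((x, y) - (xbar, 0)) * norm (xs, ys)"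
    if "(x, y) \<in> gph F" "norm ((x, y) - (xbar, 0)) \<le> \<delta>" "L \<in> adj_SC_deriv F (x, y)" "(ys, xs) \<in> L"
    for x y ys xs L
  proof -
    have "(x, y) \<in> gph F \<inter> cball (xbar, 0) \<delta>"
      using that(1,2) by (simp add: dist_norm norm_minus_commute del: diff_Pair)
    with ball have "\<forall>(ys, xs) \<in> \<Union> (adj_SC_deriv F (x, y)).
      \<bar>xs \<bullet> (x - xbar) - ys \<bullet> (y - 0)\<bar> \<le> \<epsilon> * norm ((x, y) - (xbar, 0)) * norm (xs, ys)"
      by blast
    with UnionI[OF that(3,4)] show ?thesis by auto
  qed
  \<comment> \<open>The radius \<open>\<delta> / \<eta>\<close> for \<open>x\<close> keeps
    \<open>(xh, yh)\<close> within \<delta> of \<open>(xbar, 0)\<close>, where the semismoothness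
    estimate applies.\<close>
  have "norm (x' - xbar) \<le> c * norm (x - xbar)"
    if x: "norm (x - xbar) \<le> \<delta> / \<eta>" and step: "newton_step F xh yh A B x'"
      and G: "(xh, yh, rge (transpose B) (transpose A)) \<in> G_set F xbar \<eta> \<kappa> x"
    for x xh yh A B x'
  proof -
    let ?L = "rge (transpose B) (transpose A)" and ?z = "(xh, yh) - (xbar, 0)"
    define u where "u = x' - xbar"
    from G have gph: "(xh, yh) \<in> gph F" and z: "norm ?z \<le> \<eta> * norm (x - xbar)"
      and L: "?L \<in> adj_SC_deriv F (xh, yh)" "?L \<in> Zn_reg" and \<kappa>: "onorm ((*v) (C_mat ?L)) \<le> \<kappa>"
      by (auto simp: G_set_def)
    have z\<delta>: "norm ?z \<le> \<delta>"
      using z x \<open>\<eta> > 0\<close> by (simp add: pos_le_divide_eq mult.commute)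
    from step obtain dx where dx: "A *v dx = - (B *v yh)" "x' = xh + dx"
      by (auto simp: newton_step_def)
    obtain p where p: "u = transpose A *v p" "C_mat ?L *v u = transpose B *v p"
      using rge_solve[OF L(2)] by blast
    define v where "v = transpose B *v p"
    have "(v, u) \<in> ?L"
      unfolding rge_def v_def p(1) by blast
    \<comment> \<open>Both sides equal the inner product of \<open>p\<close> with
      \<open>A *v dx\<close>, after moving the transposes across and using the Newton
      equation.\<close>
    have "u \<bullet> dx = - (v \<bullet> yh)"
      unfolding p(1) v_def transpose_matrix_vector dot_lmul_matrix dx(1) by simp
    then have "u \<bullet> u = u \<bullet> (xh - xbar) - v \<bullet> yh"
      by (simp add: u_def dx(2) inner_diff_right inner_add_right)
    then have le: "norm u * norm u \<le> \<epsilon> * norm ?z * norm (u, v)"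
      using \<delta>[OF gph z\<delta> L(1) \<open>(v, u) \<in> ?L\<close>] by (simp add: norm_eq_sqrt_inner)
    have "norm (u, v) \<le> (1 + \<kappa>) * norm u"
    proof -
      have "norm v \<le> onorm ((*v) (C_mat ?L)) * norm u"
        unfolding v_def p(2)[symmetric] by (rule onorm) (rule matrix_vector_mul_bounded_linear)
      also have "\<dots> \<le> \<kappa> * norm u" using \<kappa> by (simp add: mult_right_mono)
      finally show ?thesis
        using norm_Pair_le[of u v] by (simp add: algebra_simps)
    qed
    then have "\<epsilon> * norm ?z * norm (u, v) \<le> \<epsilon> * (\<eta> * norm (x - xbar)) * ((1 + \<kappa>) * norm u)"
      using z \<open>\<epsilon> > 0\<close> assms by (intro mult_mono) auto
    with le have "norm u * norm u \<le> \<epsilon> * (\<eta> * norm (x - xbar)) * ((1 + \<kappa>) * norm u)" by linarith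
    also have "\<dots> = (\<epsilon> * (\<eta> * (1 + \<kappa>))) * norm (x - xbar) * norm u"
      by (simp add: mult_ac)
    also have "\<epsilon> * (\<eta> * (1 + \<kappa>)) = c"
      using assms by (simp add: \<epsilon>_def)
    finally have "norm u * norm u \<le> c * norm (x - xbar) * norm u" .
    then show ?thesis
      using \<open>c > 0\<close> by (cases "u = 0") (auto simp: u_def)
  qed
  then show ?thesis
    using \<open>\<delta> > 0\<close> \<open>\<eta> > 0\<close> by (intro exI[of _ "\<delta> / \<eta>"]) auto
qed

theorem theorem5p4:
  fixes F :: "real^'n \<Rightarrow> (real^'n) set" and xbar :: "real^'n" and \<eta> \<kappa> :: real
  assumes "(xbar, 0) \<in> gph F"
    and "locally_closed_around (gph F) (xbar, 0)"
    and "SCD_semismooth_star F (xbar, 0)"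
    and "\<eta> > 0" and "\<kappa> > 0"
    and "\<forall>\<^sub>F x in nhds xbar. 0 \<notin> F x \<longrightarrow> G_set F xbar \<eta> \<kappa> x \<noteq> {}"
  shows "\<exists>\<delta>>0. \<forall>x0 \<in> cball xbar \<delta>. \<forall>N x xh yh A B.
    x 0 = x0 \<and> newton_run F xbar \<eta> N x xh yh A B \<and>
    choices_in_G F xbar \<eta> \<kappa> N x xh yh A B \<and> complete_run F xbar \<eta> \<kappa> N x \<longrightarrow>
    (\<exists>m. N = enat m \<and> 0 \<in> F (x m)) \<or> (N = \<infinity> \<and> superlinear_conv x xbar)"
proof -
  note contraction = newton_step_contraction[OF assms(3-5)]
  obtain d where "d > 0" and d: "\<And>x. dist x xbar < d \<Longrightarrow> 0 \<notin> F x \<Longrightarrow> G_set F xbar \<eta> \<kappa> x \<noteq> {}"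
    using assms(6) unfolding eventually_nhds_metric by blast
  obtain e where "e > 0" and e: "\<And>x xh yh A B x'. norm (x - xbar) \<le> e \<Longrightarrow>
      newton_step F xh yh A B x' \<Longrightarrow>
      (xh, yh, rge (transpose B) (transpose A)) \<in> G_set F xbar \<eta> \<kappa> x \<Longrightarrow>
      norm (x' - xbar) \<le> 1 / 2 * norm (x - xbar)"
    using contraction[of "1 / 2"] by (auto; blast)
  \<comment> \<open>Within \<open>e\<close> each step halves the error. The bound
    \<open>d / 2\<close> puts the closed ball inside the open ball where \<open>G_set\<close> is
    nonempty at non-solutions.\<close>
  define \<delta> where "\<delta> = min e (d / 2)"
  have \<delta>: "0 < \<delta>" "\<delta> \<le> e" "\<delta> < d" using \<open>d > 0\<close> \<open>e > 0\<close> by (auto simp: \<delta>_def)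
  have "(\<exists>m. N = enat m \<and> 0 \<in> F (x m)) \<or> (N = \<infinity> \<and> superlinear_conv x xbar)"
    if x0: "x 0 \<in> cball xbar \<delta>" and run: "newton_run F xbar \<eta> N x xh yh A B"
      and choices: "choices_in_G F xbar \<eta> \<kappa> N x xh yh A B"
      and complete: "complete_run F xbar \<eta> \<kappa> N x"
    for N x xh yh A B
  proof -
    have step: "newton_step F (xh k) (yh k) (A k) (B k) (x (Suc k))"
      and G: "(xh k, yh k, rge (transpose (B k)) (transpose (A k))) \<in> G_set F xbar \<eta> \<kappa> (x k)"
      if "enat k < N" for k
      using run choices that by (auto simp: newton_run_def choices_in_G_def)
    \<comment> \<open>The case \<open>k = N\<close> is included because the last iterate of a finite
      run must also be located.\<close>
    have bound: "norm (x k - xbar) \<le> (1 / 2) ^ k * \<delta>" if "enat k \<le> N" for k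
      using that
    proof (induction k)
      case 0
      then show ?case using x0 by (simp add: dist_norm norm_minus_commute)
    next
      case (Suc k)
      then have k: "enat k < N" by (meson enat_ord_simps(2) lessI order_less_le_trans)
      have IH: "norm (x k - xbar) \<le> (1 / 2) ^ k * \<delta>" using Suc.IH k by simp
      also have "\<dots> \<le> 1 * \<delta>" using \<delta> by (intro mult_right_mono) (auto intro: power_le_one)
      finally have "norm (x k - xbar) \<le> e" using \<delta> by simp
      then have "norm (x (Suc k) - xbar) \<le> 1 / 2 * norm (x k - xbar)"
        using e step[OF k] G[OF k] by blast
      then show ?case using IH by simp
    qed
    show ?thesis
    proof (cases N)
      case (enat m)
      have "norm (x m - xbar) \<le> (1 / 2) ^ m * \<delta>" using bound enat by simp
      also have "\<dots> \<le> 1 * \<delta>" using \<delta> by (intro mult_right_mono) (auto intro: power_le_one)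
      finally have "dist (x m) xbar < d" using \<delta> by (simp add: dist_norm)
      \<comment> \<open>Completeness leaves only the stopping test or a breakdown, and a breakdown
        at a non-solution is excluded so close to \<open>xbar\<close>.\<close>
      then have "0 \<in> F (x m)"
        using complete enat d by (auto simp: complete_run_def can_iterate_iff)
      then show ?thesis using enat by blast
    next
      case infinity
      have "(\<lambda>k. (1 / 2) ^ k * \<delta>) \<longlonglongrightarrow> 0"
        by (intro tendsto_mult_left_zero LIMSEQ_power_zero) simp
      then have "(\<lambda>k. x k - xbar) \<longlonglongrightarrow> 0"
        by (rule Lim_null_comparison[rotated]) (use bound infinity in simp)
      then have lim: "x \<longlonglongrightarrow> xbar" by (simp add: LIM_zero_iff)
      have "(\<lambda>k. norm (x (Suc k) - xbar)) \<in> o(\<lambda>k. norm (x k - xbar))"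
      proof (rule landau_o.smallI)
        \<comment> \<open>Since the iterates converge, they eventually enter the radius
          \<open>r\<close> belonging to this \<open>c\<close>.\<close>
        fix c :: real assume "c > 0"
        then obtain r where "r > 0" and r: "\<And>x xh yh A B x'. norm (x - xbar) \<le> r \<Longrightarrow>
            newton_step F xh yh A B x' \<Longrightarrow>
            (xh, yh, rge (transpose B) (transpose A)) \<in> G_set F xbar \<eta> \<kappa> x \<Longrightarrow>
            norm (x' - xbar) \<le> c * norm (x - xbar)"
          using contraction[of c] by (auto; blast)
        have "\<forall>\<^sub>F k in sequentially. dist (x k) xbar < r"
          using lim \<open>r > 0\<close> by (rule tendstoD)
        then show "\<forall>\<^sub>F k in sequentially. norm (norm (x (Suc k) - xbar)) \<le> c * norm (norm (x k - xbar))"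
        proof eventually_elim
          case (elim k)
          then show ?case
            using r[OF _ step G] infinity by (simp add: dist_norm)
        qed
      qed
      then show ?thesis using lim infinity by (simp add: superlinear_conv_def)
    qed
  qed
  then show ?thesis using \<delta>(1) by blast
qed

end
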